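(* The property SWA does not imply the property SWD: there exist a sequence $(\Omega_N)_N$ of finite sets with $\#\Omega_N=N$ and a distance function $d$ on $\mathbf{\Omega}=\bigcup_N\Omega_N$ such that $(\mathbf{\Omega},d)$ is an SWA but not an SWD.
   Context: For $N\ge 2$ put $d_N=\max\{d(A,B): A,B\in\Omega_N\}$ (the diameter of $\Omega_N$) and $\mu_N=\frac{1}{N(N-1)}\sum_{A,B\in\Omega_N, A\neq B} d(A,B)$ (the average distance; the sum is over ordered pairs). $(\mathbf{\Omega},d)$ is called an SWD (small world based on the diameter) if there is a finite constant $C\ge 0$ with $\lim_{N\to\infty} \frac{d_N}{\ln N}=C$; it is called an SWA (small world based on the average distance) if there is a finite $C\ge 0$ with $\lim_{N\to\infty}\frac{\mu_N}{\ln N}=C$. A distance function is a metric in the usual sense. *)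

theory Defs
  imports "HOL-Analysis.Analysis"
begin

(* Omega_0 is forced to be empty, so admitting N = 0 as an index changes neither the union
   nor the limits below. The union is always countably infinite, so points can be taken to be
   natural numbers without loss of generality. *)
definition set_sequence :: "(nat \<Rightarrow> 'a set) \<Rightarrow> bool" where
  "set_sequence \<Omega> \<longleftrightarrow> (\<forall>N. finite (\<Omega> N) \<and> card (\<Omega> N) = N)"

definition diam :: "(nat \<Rightarrow> 'a set) \<Rightarrow> ('a \<Rightarrow> 'a \<Rightarrow> real) \<Rightarrow> nat \<Rightarrow> real" where
  "diam \<Omega> d N = Max {d A B | A B. A \<in> \<Omega> N \<and> B \<in> \<Omega> N}"

definition avg_dist :: "(nat \<Rightarrow> 'a set) \<Rightarrow> ('a \<Rightarrow> 'a \<Rightarrow> real) \<Rightarrow> nat \<Rightarrow> real" where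
  "avg_dist \<Omega> d N =
     1 / (real N * (real N - 1)) * (\<Sum>(A, B) \<in> {(A, B). A \<in> \<Omega> N \<and> B \<in> \<Omega> N \<and> A \<noteq> B}. d A B)"

definition SWD :: "(nat \<Rightarrow> 'a set) \<Rightarrow> ('a \<Rightarrow> 'a \<Rightarrow> real) \<Rightarrow> bool" where
  "SWD \<Omega> d \<longleftrightarrow> (\<exists>C::real. C \<ge> 0 \<and> (\<lambda>N. diam \<Omega> d N / ln (real N)) \<longlonglongrightarrow> C)"

definition SWA :: "(nat \<Rightarrow> 'a set) \<Rightarrow> ('a \<Rightarrow> 'a \<Rightarrow> real) \<Rightarrow> bool" where
  "SWA \<Omega> d \<longleftrightarrow> (\<exists>C::real. C \<ge> 0 \<and> (\<lambda>N. avg_dist \<Omega> d N / ln (real N)) \<longlonglongrightarrow> C)"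

end

(* Each Omega_N consists of N - 1 points at distance 2 from each other together with one outlier
   that is private to Omega_N and at distance of order N from all the others. The outlier makes the
   diameter grow linearly, but it occurs in only a fraction 2 / N of the pairs, so the average
   distance stays bounded and its quotient by ln N tends to 0. *)

theory Submission
  imports Defs "HOL-Real_Asymp.Real_Asymp"
begin

text \<open>This is the path metric between the leaves of a star, the leaf \<open>x\<close> being
  joined to the hub by an edge of length \<open>h x\<close>.\<close>

definition star_dist :: "('a \<Rightarrow> real) \<Rightarrow> 'a \<Rightarrow> 'a \<Rightarrow> real" where
  "star_dist h A B = (if A = B then 0 else h A + h B)"

text \<open>Parity separates ordinary points (even) from outliers (odd), so a single metric serves
  all N at once; an outlier lies as far from the hub as its label is large.\<close>

definition height :: "nat \<Rightarrow> real" where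
  "height n = (if even n then 1 else real n)"

text \<open>The even points are shared between the sets. The case N = 0 is separate because the
  other branch always contains the outlier.\<close>

definition outlier_set :: "nat \<Rightarrow> nat set" where
  "outlier_set N = (if N = 0 then {} else insert (2 * N + 1) ((*) 2 ` {..<N - 1}))"

lemma height_pos: "height n > 0"
  by (auto simp: height_def elim: oddE)

text \<open>Between distinct points, a detour through a third point \<open>y\<close> costs an extra
  \<open>2 * h y\<close>; positivity of \<open>h\<close> separates points.\<close>

lemma Metric_space_star_dist:
  assumes "\<And>x. h x > 0"
  shows "Metric_space M (star_dist h)"
proof
  show "0 \<le> star_dist h x y" for x y
    using assms[of x] assms[of y] by (simp add: star_dist_def)
  show "star_dist h x y = star_dist h y x" for x y
    by (simp add: star_dist_def)
  show "star_dist h x y = 0 \<longleftrightarrow> x = y" for x y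
    using assms[of x] assms[of y] by (simp add: star_dist_def)
  show "star_dist h x z \<le> star_dist h x y + star_dist h y z" for x y z
    using assms[of x] assms[of y] assms[of z] by (auto simp: star_dist_def)
qed

lemma finite_outlier_set: "finite (outlier_set N)"
  by (simp add: outlier_set_def)

lemma outlier_notin_evens: "2 * N + 1 \<notin> (*) 2 ` X" for N :: nat
  by (auto simp: image_iff) presburger

lemma card_outlier_set: "card (outlier_set N) = N"
  using outlier_notin_evens[of N "{..<N - 1}"]
  by (auto simp: outlier_set_def card_image inj_on_def)

text \<open>The even points contribute N - 1 and the outlier 2N + 1, so the outlier affects only the
  constant of a linear total.\<close>

lemma sum_height_outlier_set: "(\<Sum>x\<in>outlier_set N. height x) = 3 * real N"
proof (cases "N = 0")
  case False
  have "(\<Sum>x\<in>(*) 2 ` {..<N - 1}. height x) = real (N - 1)"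
    by (subst sum.reindex) (auto simp: inj_on_def height_def)
  then show ?thesis
    using False outlier_notin_evens[of N "{..<N - 1}"]
    by (simp add: outlier_set_def height_def)
qed (simp add: outlier_set_def)

text \<open>Over all ordered pairs, diagonal included, each height is counted 2N times. Admitting
  the diagonal costs only a factor N / (N - 1).\<close>

lemma avg_dist_star_dist_le:
  assumes fin: "finite (\<Omega> N)" and card: "card (\<Omega> N) = N" and "N \<ge> 2"
    and h: "\<And>x. h x \<ge> 0"
  shows "avg_dist \<Omega> (star_dist h) N \<le> 2 * (\<Sum>x\<in>\<Omega> N. h x) / (real N - 1)"
proof -
  let ?P = "{(A, B). A \<in> \<Omega> N \<and> B \<in> \<Omega> N \<and> A \<noteq> B}"
  have "(\<Sum>(A, B)\<in>?P. star_dist h A B) \<le> (\<Sum>(A, B)\<in>\<Omega> N \<times> \<Omega> N. h A + h B)"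
  proof (rule sum_le_included[where i = id])
    show "finite ?P"
      by (rule finite_subset[of _ "\<Omega> N \<times> \<Omega> N"]) (use fin in auto)
  qed (use fin h in \<open>auto simp: star_dist_def\<close>)
  also have "\<dots> = 2 * real N * (\<Sum>x\<in>\<Omega> N. h x)"
    by (simp add: card sum.distrib flip: sum.cartesian_product sum_distrib_left)
  finally have "avg_dist \<Omega> (star_dist h) N
      \<le> 1 / (real N * (real N - 1)) * (2 * real N * (\<Sum>x\<in>\<Omega> N. h x))"
    unfolding avg_dist_def using \<open>N \<ge> 2\<close> by (intro mult_left_mono) auto
  also have "\<dots> = 2 * (\<Sum>x\<in>\<Omega> N. h x) / (real N - 1)"
    using \<open>N \<ge> 2\<close> by simp
  finally show ?thesis .
qed

lemma avg_dist_nonneg: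
  assumes "N \<ge> 2" "\<And>x y. d x y \<ge> 0"
  shows "avg_dist \<Omega> d N \<ge> 0"
  unfolding avg_dist_def using assms by (intro mult_nonneg_nonneg sum_nonneg) auto

lemma dist_le_diam:
  assumes "finite (\<Omega> N)" "A \<in> \<Omega> N" "B \<in> \<Omega> N"
  shows "d A B \<le> diam \<Omega> d N"
proof -
  \<comment> \<open>As an image of a finite product the set is finite, which \<open>Max\<close>
    needs.\<close>
  have "{d A B |A B. A \<in> \<Omega> N \<and> B \<in> \<Omega> N} = (\<lambda>(A, B). d A B) ` (\<Omega> N \<times> \<Omega> N)"
    by auto
  then show ?thesis
    unfolding diam_def using assms by (intro Max_ge) auto
qed

lemma SWA_outlier_set: "SWA outlier_set (star_dist height)"
proof -
  have "(\<lambda>N. avg_dist outlier_set (star_dist height) N / ln (real N)) \<longlonglongrightarrow> 0"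
  proof (rule tendsto_sandwich)
    show "eventually (\<lambda>N. 0 \<le> avg_dist outlier_set (star_dist height) N / ln (real N)) sequentially"
      \<comment> \<open>From N = 2 on, both N (N - 1) and ln N are positive.\<close>
      using eventually_ge_at_top[of 2]
      by eventually_elim
        (auto intro!: divide_nonneg_nonneg avg_dist_nonneg
          simp: star_dist_def height_pos add_nonneg_nonneg less_imp_le)
    show "eventually (\<lambda>N. avg_dist outlier_set (star_dist height) N / ln (real N)
            \<le> 6 * real N / (real N - 1) / ln (real N)) sequentially"
      using eventually_ge_at_top[of 2]
    proof eventually_elim
      case (elim N)
      \<comment> \<open>The 6 is twice the factor 3 in the sum of the heights.\<close>
      have "avg_dist outlier_set (star_dist height) N \<le> 6 * real N / (real N - 1)"
        using avg_dist_star_dist_le[of outlier_set N height] elim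
        by (simp add: finite_outlier_set card_outlier_set sum_height_outlier_set height_pos less_imp_le)
      then show ?case
        using elim by (intro divide_right_mono) auto
    qed
    show "(\<lambda>N. 6 * real N / (real N - 1) / ln (real N)) \<longlonglongrightarrow> 0"
      by real_asymp
  qed simp
  then show ?thesis
    unfolding SWA_def by auto
qed

lemma not_SWD_outlier_set: "\<not> SWD outlier_set (star_dist height)"
proof -
  have "filterlim (\<lambda>N. diam outlier_set (star_dist height) N / ln (real N)) at_top sequentially"
  proof (rule filterlim_at_top_mono)
    show "filterlim (\<lambda>N. real N / ln (real N)) at_top sequentially"
      by real_asymp
    show "eventually (\<lambda>N. real N / ln (real N)
            \<le> diam outlier_set (star_dist height) N / ln (real N)) sequentially"
      using eventually_ge_at_top[of 2]
    proof eventually_elim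
      case (elim N)
      \<comment> \<open>The point 0 is present because N - 1 is at least 1; its distance to the
        outlier is 1 + (2N + 1), more than the N required.\<close>
      have "0 \<in> outlier_set N" "2 * N + 1 \<in> outlier_set N"
        using elim by (auto simp: outlier_set_def image_iff intro!: bexI[of _ 0])
      then have "star_dist height 0 (2 * N + 1) \<le> diam outlier_set (star_dist height) N"
        by (intro dist_le_diam finite_outlier_set)
      then have "real N \<le> diam outlier_set (star_dist height) N"
        by (simp add: star_dist_def height_def)
      then show ?case
        using elim by (intro divide_right_mono) auto
    qed
  qed
  \<comment> \<open>A sequence tending to infinity has no finite limit, so every candidate C
    fails.\<close>
  then show ?thesis
    unfolding SWD_def
    using not_tendsto_and_filterlim_at_infinity[OF sequentially_bot]
      filterlim_at_top_imp_at_infinity by blast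
qed

theorem mainTheorem2:
  shows "\<exists>(\<Omega> :: nat \<Rightarrow> nat set) (d :: nat \<Rightarrow> nat \<Rightarrow> real).
           set_sequence \<Omega> \<and> Metric_space (\<Union>N. \<Omega> N) d \<and> SWA \<Omega> d \<and> \<not> SWD \<Omega> d"
proof (intro exI conjI)
  show "set_sequence outlier_set"
    by (simp add: set_sequence_def finite_outlier_set card_outlier_set)
  show "Metric_space (\<Union>N. outlier_set N) (star_dist height)"
    by (rule Metric_space_star_dist) (rule height_pos)
qed (rule SWA_outlier_set not_SWD_outlier_set)+

end
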